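(* For $n\ge 0$ let $u_1(n)$ be the number of permutations $a_1a_2\cdots a_n$ of $[n]=\{1,\dots,n\}$ containing exactly one occurrence of the pattern $1\text{-}23$, and let $B_n$ denote the $n$th Bell number. Then $u_1(0)=0$ and, for every integer $n\ge -1$, $$u_1(n+2)=2u_1(n+1)+\sum_{k=0}^{n-1}\binom{n}{k}\bigl[u_1(k+1)+B_{k+1}\bigr].$$
   Context: An occurrence of the pattern $1\text{-}23$ in a permutation $\pi=a_1a_2\cdots a_n$ is a pair of indices $(i,j)$ with $1\le i<j<n$ such that $a_i<a_j<a_{j+1}$ (the last two letters must be adjacent in $\pi$, the first need not be adjacent to them). The Bell numbers are $B_0=1,B_1=1,B_2=2,B_3=5,B_4=15,\dots$ (number of set partitions of an $n$-set). *)

theory Defs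
  imports "HOL-Combinatorics.Multiset_Permutations" "HOL-Library.Disjoint_Sets"
begin

(* A permutation a_1 ... a_n is the list of its values in one-line notation. List positions
   start at 0, so the pair (i, j) below is the pair (i + 1, j + 1) of indices into a_1 ... a_n. *)
definition occ_1_23 :: "nat list \<Rightarrow> (nat \<times> nat) set" where
  "occ_1_23 as = {(i, j). i < j \<and> j + 1 < length as \<and> as ! i < as ! j \<and> as ! j < as ! (j + 1)}"

definition u1 :: "nat \<Rightarrow> nat" where
  "u1 n = card {as \<in> permutations_of_set {1..n}. card (occ_1_23 as) = 1}"

definition Bell :: "nat \<Rightarrow> nat" where
  "Bell n = card {P. partition_on {1..n} P}"

end

theory Submission
  imports Defs "HOL-Library.Infinite_Set"
begin

text \<open>
  A permutation avoids 1-23 iff the letters after its minimum are decreasing and those before it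
  form an avoiding word. Hence the avoiders satisfy the recurrence of the Bell numbers, where the
  letters after the minimum play the role of the other members of its block.

  A permutation of \<open>{1..n + 2}\<close> with exactly one occurrence is of one of three kinds. If 2 precedes
  1, then the letters after 1 are decreasing, since an ascent there would form occurrences with
  both 1 and 2; so the occurrence lies before 1. If 2 is the last letter, then it takes part in no
  occurrence and can be deleted. Otherwise 1, 2 and the letter after 2 form the only occurrence;
  then the letters after 2 are decreasing and those before 2 form an avoiding word containing 1.
\<close>

section \<open>Sums over subsets, grouped by cardinality\<close>

lemma sum_Pow_card:
  fixes f :: "nat \<Rightarrow> 'b::comm_semiring_1"
  assumes "finite A"
  shows "(\<Sum>X\<in>Pow A. f (card X)) = (\<Sum>k\<le>card A. of_nat (card A choose k) * f k)"
proof -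
  have "(\<Sum>X\<in>Pow A. f (card X)) = (\<Sum>k\<le>card A. \<Sum>X\<in>{X\<in>Pow A. card X = k}. f (card X))"
    using assms by (intro sum.group[symmetric]) (auto intro: card_mono)
  also have "\<dots> = (\<Sum>k\<le>card A. of_nat (card {X\<in>Pow A. card X = k}) * f k)"
    by (intro sum.cong) auto
  also have "\<dots> = (\<Sum>k\<le>card A. of_nat (card A choose k) * f k)"
    using n_subsets[OF assms] by (simp add: Pow_def)
  finally show ?thesis .
qed

lemma sum_psubsets_card:
  fixes f :: "nat \<Rightarrow> nat"
  assumes "finite A"
  shows "(\<Sum>X\<in>Pow A - {A}. f (card X)) = (\<Sum>k<card A. (card A choose k) * f k)"
proof -
  have "(\<Sum>X\<in>Pow A. f (card X)) = f (card A) + (\<Sum>X\<in>Pow A - {A}. f (card X))"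
    using assms by (intro sum.remove) auto
  then show ?thesis
    using sum_Pow_card[OF assms, of f] by (simp add: lessThan_Suc_atMost[symmetric])
qed

section \<open>Decreasing words\<close>

definition desc_list :: "nat set \<Rightarrow> nat list" where
  "desc_list T = rev (sorted_list_of_set T)"

lemma set_desc_list [simp]: "finite T \<Longrightarrow> set (desc_list T) = T"
  by (simp add: desc_list_def)

lemma distinct_desc_list [simp]: "distinct (desc_list T)"
  by (simp add: desc_list_def)

lemma desc_list_empty [simp]: "desc_list {} = []"
  by (simp add: desc_list_def)

lemma sorted_desc_list [simp]: "sorted_wrt (>) (desc_list T)"
  by (simp add: desc_list_def sorted_wrt_rev)

text \<open>A decreasing word is determined by its set of letters, so a decreasing suffix can be
  recorded by a set alone.\<close>

lemma desc_list_set: "sorted_wrt (>) E \<Longrightarrow> desc_list (set E) = E"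
  using sorted_list_of_set.idem_if_sorted_distinct[of "rev E"] strict_sorted_iff[of "rev E"]
  by (simp add: desc_list_def sorted_wrt_rev rev_swap)

section \<open>Occurrences under concatenation and relabelling\<close>

lemma finite_occ_1_23 [simp]: "finite (occ_1_23 as)"
  by (rule finite_subset[of _ "{..<length as} \<times> {..<length as}"]) (auto simp: occ_1_23_def)

lemma occ_1_23_Nil [simp]: "occ_1_23 [] = {}"
  by (simp add: occ_1_23_def)

lemma occ_1_23_append_mono: "occ_1_23 xs \<subseteq> occ_1_23 (xs @ ys)"
  by (auto simp: occ_1_23_def nth_append)

text \<open>The cases are the possible positions of \<open>j\<close>. Inside \<open>E\<close> there
  is no ascent, and \<open>low\<close> excludes an occurrence whose last letter is \<open>m\<close>;
  what remains is an occurrence within \<open>xs\<close>, or one whose middle letter is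
  \<open>m\<close>. The hypothesis \<open>low\<close> holds whenever at most one letter of
  \<open>xs\<close> is below \<open>m\<close>, as when \<open>m\<close> is the least or second least
  letter.\<close>

lemma occ_1_23_append_desc:
  assumes E: "sorted_wrt (>) E"
    and low: "\<And>i j. i < j \<Longrightarrow> j < length xs \<Longrightarrow> \<not> (xs ! i < xs ! j \<and> xs ! j < m)"
  shows "occ_1_23 (xs @ m # E) =
    occ_1_23 xs \<union> {(i, j). j = length xs \<and> i < j \<and> xs ! i < m \<and> E \<noteq> [] \<and> m < hd E}"
    (is "?L = ?R")
proof (intro equalityI subrelI)
  fix i j assume "(i, j) \<in> ?L"
  then have ij: "i < j" "j + 1 < length xs + Suc (length E)"
    "(xs @ m # E) ! i < (xs @ m # E) ! j" "(xs @ m # E) ! j < (xs @ m # E) ! (j + 1)"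
    by (auto simp: occ_1_23_def)
  consider "j + 1 < length xs" | "j + 1 = length xs" | "j = length xs"
    | k where "j = length xs + Suc k"
    by (metis Suc_eq_plus1 add_Suc_right less_imp_Suc_add linorder_neqE_nat not_less_eq)
  then show "(i, j) \<in> ?R"
  proof cases
    case 1 then show ?thesis using ij by (auto simp: occ_1_23_def nth_append)
  next
    case 2 then show ?thesis using ij low[of i j] by (auto simp: nth_append)
  next
    case 3 then show ?thesis using ij by (auto simp: nth_append hd_conv_nth)
  next
    case 4
    then have "Suc k < length E" "E ! k < E ! Suc k" using ij by (auto simp: nth_append)
    moreover have "E ! Suc k < E ! k" using sorted_wrt_nth_less[OF E, of k "Suc k"] \<open>Suc k < length E\<close> by simp
    ultimately show ?thesis by simp
  qed
next
  fix i j assume "(i, j) \<in> ?R"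
  then show "(i, j) \<in> ?L"
    by (auto simp: occ_1_23_def nth_append hd_conv_nth)
qed

text \<open>An ascent in \<open>ys\<close> serves as the \<open>23\<close> for every sufficiently
  small letter of \<open>xs\<close>. The index \<open>j\<close> does not depend on \<open>p\<close>,
  so two such letters yield two different occurrences.\<close>

lemma not_desc_imp_occ_1_23:
  assumes "distinct ys" "\<not> sorted_wrt (>) ys"
  obtains j where "length xs \<le> j"
    "\<And>p. p < length xs \<Longrightarrow> (\<And>y. y \<in> set ys \<Longrightarrow> xs ! p < y) \<Longrightarrow> (p, j) \<in> occ_1_23 (xs @ ys)"
proof -
  \<comment> \<open>By transitivity, failure to decrease shows at two adjacent letters; distinctness
    makes the ascent there strict.\<close>
  have "transp ((>) :: nat \<Rightarrow> nat \<Rightarrow> bool)" by (auto intro: transpI)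
  then obtain k where k: "Suc k < length ys" "\<not> ys ! k > ys ! Suc k"
    using assms(2) by (auto simp: sorted_wrt_iff_nth_Suc_transp)
  then have "ys ! k < ys ! Suc k"
    using assms(1) by (metis Suc_lessD linorder_neqE_nat n_not_Suc_n nth_eq_iff_index_eq)
  then show thesis
    using k by (intro that[of "length xs + k"]) (auto simp: occ_1_23_def nth_append)
qed

lemma occ_1_23_map:
  assumes "strict_mono_on S f" "set as \<subseteq> S"
  shows "occ_1_23 (map f as) = occ_1_23 as"
proof -
  have "f (as ! i) < f (as ! j) \<longleftrightarrow> as ! i < as ! j" if "i < length as" "j < length as" for i j
    using that assms by (intro strict_mono_on_less) auto
  then show ?thesis by (auto simp: occ_1_23_def)
qed

section \<open>Words on an arbitrary finite alphabet with a given number of occurrences\<close>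

text \<open>The alphabet is arbitrary because the prefixes cut off in the decompositions use
  arbitrary sets of letters.\<close>

definition perms_occ :: "nat \<Rightarrow> nat set \<Rightarrow> nat list set" where
  "perms_occ c S = {as \<in> permutations_of_set S. card (occ_1_23 as) = c}"

lemma finite_perms_occ [simp]: "finite (perms_occ c S)"
  by (simp add: perms_occ_def)

lemma perms_occ_iff:
  "as \<in> perms_occ c S \<longleftrightarrow> set as = S \<and> distinct as \<and> card (occ_1_23 as) = c"
  by (auto simp: perms_occ_def permutations_of_set_def)

lemma card_perms_occ_image:
  assumes "strict_mono_on S f"
  shows "card (perms_occ c (f ` S)) = card (perms_occ c S)"
proof -
  have inj: "inj_on f S" using assms by (rule strict_mono_on_imp_inj_on)
  have "perms_occ c (f ` S) = map f ` perms_occ c S"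
    using occ_1_23_map[OF assms]
    by (auto simp: perms_occ_def permutations_of_set_image_inj[OF inj] permutations_of_setD)
  moreover have "inj_on (map f) (perms_occ c S)"
    by (rule inj_onI) (metis inj inj_on_map_eq_map perms_occ_iff sup.idem)
  ultimately show ?thesis by (simp add: card_image)
qed

text \<open>Occurrences depend only on the relative order of the letters, and each finite set is an
  increasing image of an initial segment of the naturals.\<close>

lemma card_perms_occ_cong:
  assumes "finite S" "finite T" "card S = card T"
  shows "card (perms_occ c S) = card (perms_occ c T)"
proof -
  have "card (perms_occ c M) = card (perms_occ c {..<card M})" if M: "finite M" for M :: "nat set"
  proof -
    obtain h where "bij_betw h {..<card M} M" "strict_mono_on {..<card M} h"
      using ex_bij_betw_strict_mono_card[OF M] .
    then show ?thesis using card_perms_occ_image[of "{..<card M}" h c] by (simp add: bij_betw_def)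
  qed
  from this[of S] this[of T] show ?thesis using assms by simp
qed

text \<open>\<open>X\<close> is the set of letters of \<open>A\<close> placed before
  \<open>w\<close>; the other letters of \<open>A\<close> follow \<open>w\<close> in decreasing
  order. Keeping \<open>X\<close> in the pair turns the domain into a dependent sum, counted by
  summing over \<open>X\<close>.\<close>

definition glue_desc :: "nat set \<Rightarrow> nat \<Rightarrow> nat set \<times> nat list \<Rightarrow> nat list" where
  "glue_desc A w = (\<lambda>(X, \<rho>). \<rho> @ w # desc_list (A - X))"

text \<open>Gluing is injective: \<open>w\<close> occurs once, so it marks the end of
  \<open>\<rho>\<close>, and then \<open>X\<close> is the set of letters of \<open>\<rho>\<close>
  outside \<open>K\<close>. \<open>K\<close> holds the letters that must precede
  \<open>w\<close>.\<close>

lemma card_glue_desc: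
  assumes "finite A" "\<X> \<subseteq> Pow A" "w \<notin> K \<union> A" "K \<inter> A = {}"
  shows "card (glue_desc A w ` (SIGMA X:\<X>. perms_occ c (K \<union> X))) =
    (\<Sum>X\<in>\<X>. card (perms_occ c (K \<union> X)))"
proof -
  have "inj_on (glue_desc A w) (SIGMA X:\<X>. perms_occ c (K \<union> X))"
  proof (rule inj_onI, clarsimp simp: glue_desc_def perms_occ_iff)
    fix X \<rho> X' \<rho>'
    assume *: "X \<in> \<X>" "X' \<in> \<X>" "set \<rho> = K \<union> X" "set \<rho>' = K \<union> X'"
      "\<rho> @ w # desc_list (A - X) = \<rho>' @ w # desc_list (A - X')"
    have "w \<notin> set \<rho>" "w \<notin> set (desc_list (A - X))" using * assms by auto
    then have "\<rho> = \<rho>'" using *(5) by (simp add: append_Cons_eq_iff)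
    moreover have "X = X'" using * \<open>\<rho> = \<rho>'\<close> assms by blast
    ultimately show "X = X' \<and> \<rho> = \<rho>'" by simp
  qed
  moreover have "finite \<X>" using assms finite_subset by blast
  ultimately show ?thesis by (simp add: card_image)
qed

section \<open>Avoiding words and set partitions\<close>

text \<open>An ascent after \<open>m\<close> would form an occurrence with \<open>m\<close>.
  Conversely, no letter is below \<open>m\<close>, so appending \<open>m\<close> and a decreasing
  word creates no occurrence. The union with \<open>{}\<close> matches \<open>card_glue_desc\<close>
  with \<open>K\<close> empty.\<close>

lemma perms_occ_0_insert_min:
  assumes A: "finite A" and min: "\<And>x. x \<in> A \<Longrightarrow> m < x"
  shows "perms_occ 0 (insert m A) = glue_desc A m ` (SIGMA X:Pow A. perms_occ 0 ({} \<union> X))"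
proof (intro equalityI subsetI)
  fix as assume "as \<in> perms_occ 0 (insert m A)"
  then have as: "set as = insert m A" "distinct as" "occ_1_23 as = {}" by (auto simp: perms_occ_iff)
  then obtain \<rho> E where s: "as = \<rho> @ m # E" by (metis insertI1 split_list)
  have "m \<notin> A" using min by blast
  then have "A = set as - {m}" using as by simp
  then have AE: "A = set \<rho> \<union> set E" "set \<rho> \<inter> set E = {}" using as s by auto
  have E: "sorted_wrt (>) E"
  proof (rule ccontr)
    assume "\<not> sorted_wrt (>) E"
    moreover have "distinct E" using as s by simp
    ultimately obtain j where
      "length (\<rho> @ [m]) \<le> j"
      and j: "\<And>p. p < length (\<rho> @ [m]) \<Longrightarrow>
        (\<And>y. y \<in> set E \<Longrightarrow> (\<rho> @ [m]) ! p < y) \<Longrightarrow> (p, j) \<in> occ_1_23 ((\<rho> @ [m]) @ E)"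
      using not_desc_imp_occ_1_23[of E "\<rho> @ [m]"] by blast
    from j[of "length \<rho>"] show False using as s min AE by (auto simp: nth_append)
  qed
  have "A - set \<rho> = set E" using AE by blast
  then have "as = glue_desc A m (set \<rho>, \<rho>)" using s E by (simp add: glue_desc_def desc_list_set)
  moreover have "occ_1_23 \<rho> = {}" using occ_1_23_append_mono[of \<rho> "m # E"] as s by auto
  moreover have "distinct \<rho>" "set \<rho> \<subseteq> A" using as s AE by auto
  ultimately show "as \<in> glue_desc A m ` (SIGMA X:Pow A. perms_occ 0 ({} \<union> X))"
    by (intro image_eqI[of _ _ "(set \<rho>, \<rho>)"]) (auto simp: perms_occ_iff)
next
  fix as assume "as \<in> glue_desc A m ` (SIGMA X:Pow A. perms_occ 0 ({} \<union> X))"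
  then obtain X \<rho> where s: "as = \<rho> @ m # desc_list (A - X)" "X \<subseteq> A" "set \<rho> = X" "distinct \<rho>"
    "occ_1_23 \<rho> = {}"
    by (auto simp: glue_desc_def perms_occ_iff)
  \<comment> \<open>With no letter of \<open>\<rho>\<close> below \<open>m\<close>, the hypothesis
    on increasing pairs below \<open>m\<close> is vacuous and no occurrence has \<open>m\<close> in
    the middle.\<close>
  have "m < \<rho> ! i" if "i < length \<rho>" for i using that s min nth_mem by blast
  then have "occ_1_23 as = {}" using s
    by (subst s(1), subst occ_1_23_append_desc) (auto dest: less_trans less_not_sym)
  then show "as \<in> perms_occ 0 (insert m A)" using s A min
    by (auto simp: perms_occ_iff)
qed

text \<open>\<open>X\<close> is the union of the blocks that do not contain \<open>a\<close>. These
  blocks partition \<open>X\<close>, and the block of \<open>a\<close> is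
  \<open>insert a (A - X)\<close>.\<close>

lemma card_partitions_insert:
  assumes A: "finite A" and a: "a \<notin> A"
  shows "card {P. partition_on (insert a A) P} = (\<Sum>X\<in>Pow A. card {P. partition_on X P})"
proof -
  define g where "g = (\<lambda>(X, Q). insert (insert a (A - X)) Q)"
  let ?D = "SIGMA X:Pow A. {Q. partition_on X Q}"
  have no_a: "a \<notin> \<Union>Q" if "partition_on X Q" "X \<subseteq> A" for X Q
    using that a partition_onD1 by blast
  have "inj_on g ?D"
  proof (rule inj_onI, clarsimp simp: g_def)
    fix X Q X' Q'
    assume *: "X \<subseteq> A" "X' \<subseteq> A" "partition_on X Q" "partition_on X' Q'"
      "insert (insert a (A - X)) Q = insert (insert a (A - X')) Q'"
    \<comment> \<open>\<open>Q\<close> is recovered as the set of blocks without \<open>a\<close>,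
      and \<open>X\<close> as its union.\<close>
    have "Q = {q \<in> insert (insert a (A - X)) Q. a \<notin> q}" using no_a[of X Q] * by auto
    also have "\<dots> = {q \<in> insert (insert a (A - X')) Q'. a \<notin> q}" using * by simp
    also have "\<dots> = Q'" using no_a[of X' Q'] * by auto
    finally have "Q = Q'" .
    then show "X = X' \<and> Q = Q'" using partition_onD1[OF *(3)] partition_onD1[OF *(4)] by simp
  qed
  moreover have "g ` ?D = {P. partition_on (insert a A) P}"
  proof (intro equalityI subsetI)
    fix P assume "P \<in> g ` ?D"
    then obtain X Q where s: "X \<subseteq> A" "partition_on X Q" "P = insert (insert a (A - X)) Q"
      by (auto simp: g_def)
    have "\<Union>Q = X" using partition_onD1[OF s(2)] by simp
    moreover have "insert a A - insert a (A - X) = X" using s a by auto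
    moreover have "disjnt (insert a (A - X)) X" using s(1) a by (auto simp: disjnt_iff)
    ultimately show "P \<in> {P. partition_on (insert a A) P}"
      using s partition_on_insert[of "insert a (A - X)" Q "insert a A"] by auto
  next
    fix P assume "P \<in> {P. partition_on (insert a A) P}"
    then have P: "partition_on (insert a A) P" by simp
    then obtain B where B: "B \<in> P" "a \<in> B" using partition_onD1 by blast
    define Q where "Q = P - {B}"
    have PQ: "P = insert B Q" using B Q_def by auto
    have "disjnt B (\<Union>Q)"
      using partition_onD2[OF P] B by (auto simp: Q_def disjoint_def disjnt_def)
    then have 1: "partition_on (insert a A - B) Q" "B \<subseteq> insert a A"
      using P partition_on_insert[of B Q "insert a A"] by (simp_all add: PQ)
    have "insert a (A - (insert a A - B)) = B" using 1 B by auto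
    then have "P = g (insert a A - B, Q)" using PQ by (simp add: g_def)
    then show "P \<in> g ` ?D" using 1 B by blast
  qed
  ultimately have "card {P. partition_on (insert a A) P} = card ?D" by (metis card_image)
  also have "\<dots> = (\<Sum>X\<in>Pow A. card {P. partition_on X P})"
    using A by (subst card_SigmaI) (auto intro: finitely_many_partition_on finite_subset)
  finally show ?thesis .
qed

text \<open>Splitting off the minimum gives both counts the same recurrence over the subsets of the
  remaining letters. These are all proper subsets of \<open>S\<close>, whence the form of the
  induction.\<close>

lemma card_perms_occ_0_eq_partitions:
  assumes "finite S"
  shows "card (perms_occ 0 S) = card {P. partition_on S P}"
  using assms
proof (induction S rule: finite_psubset_induct)
  case (psubset S)
  show ?case
  proof (cases "S = {}")
    case True
    have "perms_occ 0 {} = {[]}" by (auto simp: perms_occ_iff)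
    then show ?thesis using True by (simp add: partition_on_empty)
  next
    case False
    define m where "m = Min S"
    define A where "A = S - {m}"
    have "m \<in> S" using psubset.hyps False by (simp add: m_def)
    then have S: "S = insert m A" "m \<notin> A" "finite A" and min: "\<And>x. x \<in> A \<Longrightarrow> m < x"
      using psubset.hyps by (auto simp: A_def m_def less_le)
    have "card (perms_occ 0 S) = (\<Sum>X\<in>Pow A. card (perms_occ 0 ({} \<union> X)))"
      using S by (simp only: perms_occ_0_insert_min[OF S(3) min], intro card_glue_desc) auto
    also have "\<dots> = (\<Sum>X\<in>Pow A. card {P. partition_on X P})"
      using S psubset.IH by (intro sum.cong) auto
    also have "\<dots> = card {P. partition_on S P}"
      using S by (simp add: card_partitions_insert)
    finally show ?thesis .
  qed
qed

section \<open>Words with exactly one occurrence\<close>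

text \<open>Here \<open>a\<close> and \<open>b\<close> play the roles of 1 and 2. The three sets
  are, in order, the words with \<open>b\<close> before \<open>a\<close>, those with
  \<open>a\<close> before \<open>b\<close> and \<open>b\<close> not last, and those ending in
  \<open>b\<close>. In the second, excluding \<open>X = A\<close> keeps the suffix after
  \<open>b\<close> nonempty.\<close>

lemma perms_occ_1_insert_two_least:
  assumes A: "finite A" and ab: "a < b" and min: "\<And>x. x \<in> A \<Longrightarrow> b < x"
  shows "perms_occ 1 (insert a (insert b A)) =
    glue_desc A a ` (SIGMA X:Pow A. perms_occ 1 ({b} \<union> X)) \<union>
    glue_desc A b ` (SIGMA X:Pow A - {A}. perms_occ 0 ({a} \<union> X)) \<union>
    (\<lambda>\<rho>. \<rho> @ [b]) ` perms_occ 1 (insert a A)" (is "?L = ?R1 \<union> ?R2 \<union> ?R3")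
proof (intro equalityI subsetI)
  fix as assume "as \<in> ?L"
  then have as: "set as = insert a (insert b A)" "distinct as" "card (occ_1_23 as) = 1"
    by (auto simp: perms_occ_iff)
  have one: "p = q" if "p \<in> occ_1_23 as" "q \<in> occ_1_23 as" for p q
    using as(3) that by (metis card_1_singletonE singletonD)
  have nin: "a \<notin> A" "b \<notin> A" using ab min by force+
  obtain \<rho> E where s: "as = \<rho> @ b # E" using as by (metis insertCI split_list)
  show "as \<in> ?R1 \<union> ?R2 \<union> ?R3"
  proof (cases "a \<in> set \<rho>")
    case False
    obtain \<sigma> \<tau> where t: "as = \<sigma> @ a # \<tau>" using as by (metis insertCI split_list)
    have "b \<in> set \<sigma>"
    proof -
      have "a \<in> set E" using False s as ab by auto
      then obtain E1 E2 where "E = E1 @ a # E2" by (meson split_list)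
      \<comment> \<open>Since \<open>a\<close> occurs only once, both splits at \<open>a\<close>
        have the same prefix, and this one contains \<open>b\<close>.\<close>
      then have "(\<rho> @ b # E1) @ a # E2 = \<sigma> @ a # \<tau>" using s t by simp
      moreover have "a \<notin> set (\<rho> @ b # E1)" "a \<notin> set E2" using s as(2) \<open>E = E1 @ a # E2\<close> by auto
      ultimately have "\<rho> @ b # E1 = \<sigma>" by (metis append_Cons_eq_iff)
      then show ?thesis by auto
    qed
    have tA: "set \<tau> \<subseteq> A" and ts: "set \<sigma> \<inter> set \<tau> = {}" using as t \<open>b \<in> set \<sigma>\<close> by auto
    have "sorted_wrt (>) \<tau>"
    proof (rule ccontr)
      assume "\<not> sorted_wrt (>) \<tau>"
      moreover have "distinct \<tau>" using as t by simp
      ultimately obtain j where "length (\<sigma> @ [a]) \<le> j" and j: "\<And>p. p < length (\<sigma> @ [a]) \<Longrightarrow>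
          (\<And>y. y \<in> set \<tau> \<Longrightarrow> (\<sigma> @ [a]) ! p < y) \<Longrightarrow> (p, j) \<in> occ_1_23 ((\<sigma> @ [a]) @ \<tau>)"
        using not_desc_imp_occ_1_23[of \<tau> "\<sigma> @ [a]"] by blast
      \<comment> \<open>Both \<open>a\<close>, at position \<open>length \<sigma>\<close>, and
        \<open>b\<close>, at position \<open>q\<close>, are below all of \<open>\<tau>\<close>, so
        the ascent at \<open>j\<close> gives two occurrences.\<close>
      obtain q where q: "q < length \<sigma>" "\<sigma> ! q = b" using \<open>b \<in> set \<sigma>\<close> by (meson in_set_conv_nth)
      have "(length \<sigma>, j) \<in> occ_1_23 as" using j[of "length \<sigma>"] tA min ab t by force
      moreover have "(q, j) \<in> occ_1_23 as" using j[of q] q tA min t by (force simp: nth_append)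
      ultimately show False using one q(1) by blast
    qed
    moreover have "a < \<sigma> ! i" if "i < length \<sigma>" for i
      using nth_mem[OF that] as t ab min by fastforce
    ultimately have "occ_1_23 as = occ_1_23 \<sigma>"
      by (subst t, subst occ_1_23_append_desc) (auto dest: less_trans less_not_sym)
    moreover have "A - (set \<sigma> - {b}) = set \<tau>" using as t \<open>b \<in> set \<sigma>\<close> nin tA ts by auto
    then have "as = glue_desc A a (set \<sigma> - {b}, \<sigma>)"
      using t \<open>sorted_wrt (>) \<tau>\<close> by (simp add: glue_desc_def desc_list_set)
    moreover have "set \<sigma> - {b} \<subseteq> A" "{b} \<union> (set \<sigma> - {b}) = set \<sigma>" "distinct \<sigma>"
      using as t \<open>b \<in> set \<sigma>\<close> by auto
    ultimately have "as \<in> ?R1"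
      using as by (intro image_eqI[of _ _ "(set \<sigma> - {b}, \<sigma>)"]) (auto simp: perms_occ_iff)
    then show ?thesis by simp
  next
    case True
    have EA: "set E \<subseteq> A" and Er: "set \<rho> \<inter> set E = {}" using as s True by auto
    have rA: "set \<rho> - {a} \<subseteq> A" "{a} \<union> (set \<rho> - {a}) = set \<rho>" "distinct \<rho>" using as s True by auto
    \<comment> \<open>The only letter of \<open>\<rho>\<close> that can be below \<open>b\<close> is
      \<open>a\<close>, so \<open>\<rho>\<close> has no increasing pair below
      \<open>b\<close>.\<close>
    have small: "x = a" if "x \<in> set \<rho>" "x < b" for x
      using that rA min by (metis DiffI less_not_sym singletonD subsetD)
    obtain q where q: "q < length \<rho>" "\<rho> ! q = a" using True by (meson in_set_conv_nth)
    have low: "\<not> (\<rho> ! i < \<rho> ! j \<and> \<rho> ! j < b)" if "i < j" "j < length \<rho>" for i j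
    proof -
      have "\<rho> ! i \<in> set \<rho>" "\<rho> ! j \<in> set \<rho>" using that by auto
      then show ?thesis using small by (metis less_irrefl less_trans)
    qed
    show ?thesis
    proof (cases "E = []")
      case True
      have "occ_1_23 as = occ_1_23 \<rho>"
        using True by (subst s, subst occ_1_23_append_desc) (use low in auto)
      moreover have "set \<rho> = insert a A" using as s True rA nin \<open>a \<in> set \<rho>\<close> by auto
      ultimately have "as \<in> ?R3" using as s True
        by (intro image_eqI[of _ _ \<rho>]) (auto simp: perms_occ_iff)
      then show ?thesis by simp
    next
      case False
      have "b < hd E" using min EA hd_in_set[OF False] by blast
      \<comment> \<open>The letters \<open>a\<close>, \<open>b\<close> and \<open>hd E\<close> form
        an occurrence; it must be the only one.\<close>
      then have o1: "(q, length \<rho>) \<in> occ_1_23 as"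
        using False q ab s by (auto simp: occ_1_23_def nth_append hd_conv_nth)
      have "sorted_wrt (>) E"
      proof (rule ccontr)
        assume "\<not> sorted_wrt (>) E"
        moreover have "distinct E" using as s by simp
        ultimately obtain j where j: "length (\<rho> @ [b]) \<le> j" "\<And>p. p < length (\<rho> @ [b]) \<Longrightarrow>
          (\<And>y. y \<in> set E \<Longrightarrow> (\<rho> @ [b]) ! p < y) \<Longrightarrow> (p, j) \<in> occ_1_23 ((\<rho> @ [b]) @ E)"
          using not_desc_imp_occ_1_23[of E "\<rho> @ [b]"] by blast
        \<comment> \<open>This occurrence also starts at \<open>a\<close>, but its \<open>j\<close>
          exceeds \<open>length \<rho>\<close>, so it differs from \<open>o1\<close>.\<close>
        have "(q, j) \<in> occ_1_23 as" using j(2)[of q] q EA min ab s by (force simp: nth_append)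
        then show False using one[OF o1] j(1) by fastforce
      qed
      \<comment> \<open>An occurrence inside \<open>\<rho>\<close> has
        \<open>j + 1 < length \<rho>\<close>, so it too would differ from \<open>o1\<close>.\<close>
      have "occ_1_23 \<rho> = {}"
      proof (rule ccontr)
        assume "occ_1_23 \<rho> \<noteq> {}"
        then obtain i j where ij: "(i, j) \<in> occ_1_23 \<rho>" by auto
        then have "(i, j) \<in> occ_1_23 as" using occ_1_23_append_mono s by blast
        then have "j = length \<rho>" using one[OF o1] by blast
        then show False using ij by (simp add: occ_1_23_def)
      qed
      moreover have "A - (set \<rho> - {a}) = set E" using as s nin EA Er \<open>a \<in> set \<rho>\<close> by auto
      then have "as = glue_desc A b (set \<rho> - {a}, \<rho>)" "set \<rho> - {a} \<noteq> A"
        using s False \<open>sorted_wrt (>) E\<close> by (auto simp: glue_desc_def desc_list_set)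
      ultimately have "as \<in> ?R2"
        using rA by (intro image_eqI[of _ _ "(set \<rho> - {a}, \<rho>)"]) (auto simp: perms_occ_iff)
      then show ?thesis by simp
    qed
  qed
next
  have nin: "a \<notin> A" "b \<notin> A" using ab min by force+
  have low: "\<not> (\<rho> ! i < \<rho> ! j \<and> \<rho> ! j < b)"
    if "i < j" "j < length \<rho>" "set \<rho> \<subseteq> insert a A" for i j \<rho>
  proof -
    have "\<rho> ! i \<in> insert a A" "\<rho> ! j \<in> insert a A" using that nth_mem less_trans by blast+
    then show ?thesis using min ab by (auto dest: less_trans less_not_sym)
  qed
  fix as assume "as \<in> ?R1 \<union> ?R2 \<union> ?R3"
  then consider "as \<in> ?R1" | "as \<in> ?R2" | "as \<in> ?R3" by blast
  then show "as \<in> ?L"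
  proof cases
    case 1
    then obtain X \<rho> where s: "as = \<rho> @ a # desc_list (A - X)" "X \<subseteq> A" "set \<rho> = insert b X"
      "distinct \<rho>" "card (occ_1_23 \<rho>) = 1"
      by (auto simp: glue_desc_def perms_occ_iff)
    have "a < \<rho> ! i" if "i < length \<rho>" for i
      using nth_mem[OF that] s(2,3) ab min by fastforce
    then have "occ_1_23 as = occ_1_23 \<rho>"
      by (subst s(1), subst occ_1_23_append_desc) (auto dest: less_trans less_not_sym)
    then show ?thesis using s A nin ab by (auto simp: perms_occ_iff)
  next
    case 2
    then obtain X \<rho> where X: "X \<in> Pow A - {A}" "\<rho> \<in> perms_occ 0 ({a} \<union> X)"
      "as = glue_desc A b (X, \<rho>)" by blast
    then have s: "as = \<rho> @ b # desc_list (A - X)" "X \<subseteq> A" "X \<noteq> A" "set \<rho> = insert a X"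
      "distinct \<rho>" "occ_1_23 \<rho> = {}"
      by (simp_all add: glue_desc_def perms_occ_iff)
    obtain q where q: "q < length \<rho>" "\<rho> ! q = a" using s(4) by (metis in_set_conv_nth insertI1)
    have q_unique: "i = q" if "i < length \<rho>" "\<rho> ! i < b" for i
    proof -
      have "\<rho> ! i = a" using nth_mem[OF that(1)] that s(2,4) min by (auto dest: less_not_sym)
      then show ?thesis using q s(5) that by (metis nth_eq_iff_index_eq)
    qed
    have setE: "set (desc_list (A - X)) = A - X" using A by simp
    have ne: "desc_list (A - X) \<noteq> []" using s(2,3) setE by force
    then have hd: "b < hd (desc_list (A - X))" using min setE hd_in_set by blast
    have "set \<rho> \<subseteq> insert a A" using s(2,4) by auto
    then have "\<not> (\<rho> ! i < \<rho> ! j \<and> \<rho> ! j < b)" if "i < j" "j < length \<rho>" for i j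
      using low that by blast
    from occ_1_23_append_desc[OF sorted_desc_list this]
    have "occ_1_23 as = occ_1_23 \<rho> \<union> {(i, j). j = length \<rho> \<and> i < j \<and> \<rho> ! i < b \<and>
        desc_list (A - X) \<noteq> [] \<and> b < hd (desc_list (A - X))}"
      unfolding s(1) .
    \<comment> \<open>In \<open>\<rho>\<close> only \<open>a\<close> is below \<open>b\<close>, and
      the suffix is nonempty and starts above \<open>b\<close>; hence exactly one pair
      arises.\<close>
    also have "\<dots> = {(q, length \<rho>)}"
      using q q_unique ab hd ne unfolding s(6) by blast
    finally have "occ_1_23 as = {(q, length \<rho>)}" .
    moreover have "set as = insert a (insert b A)" "distinct as"
      using s(2,4,5) setE nin ab unfolding s(1) by auto
    ultimately show ?thesis by (simp add: perms_occ_iff)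
  next
    case 3
    then obtain \<rho> where s: "as = \<rho> @ [b]" "set \<rho> = insert a A" "distinct \<rho>"
      "card (occ_1_23 \<rho>) = 1"
      by (auto simp: perms_occ_iff)
    have "occ_1_23 as = occ_1_23 \<rho>"
      by (subst s(1), subst occ_1_23_append_desc) (use low s(2) in auto)
    then show ?thesis using s nin ab by (auto simp: perms_occ_iff)
  qed
qed

text \<open>Two tests separate the three images: whether \<open>b\<close> precedes \<open>a\<close>,
  read off the prefix that \<open>takeWhile\<close> cuts before \<open>a\<close>, and whether
  \<open>b\<close> is the last letter.\<close>

lemma card_perms_occ_1_insert_two_least:
  assumes A: "finite A" and ab: "a < b" and min: "\<And>x. x \<in> A \<Longrightarrow> b < x"
  shows "card (perms_occ 1 (insert a (insert b A))) =
    (\<Sum>X\<in>Pow A. card (perms_occ 1 ({b} \<union> X))) +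
    (\<Sum>X\<in>Pow A - {A}. card (perms_occ 0 ({a} \<union> X))) + card (perms_occ 1 (insert a A))"
proof -
  let ?R1 = "glue_desc A a ` (SIGMA X:Pow A. perms_occ 1 ({b} \<union> X))"
  let ?R2 = "glue_desc A b ` (SIGMA X:Pow A - {A}. perms_occ 0 ({a} \<union> X))"
  let ?R3 = "(\<lambda>\<rho>. \<rho> @ [b]) ` perms_occ 1 (insert a A)"
  have nin: "a \<notin> A" "b \<notin> A" using ab min by force+
  have R1: "b \<in> set (takeWhile (\<lambda>x. x \<noteq> a) as)" if "as \<in> ?R1" for as
  proof -
    from that obtain X \<rho> where s: "as = \<rho> @ a # desc_list (A - X)" "X \<subseteq> A" "set \<rho> = insert b X"
      by (auto simp: glue_desc_def perms_occ_iff)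
    then have "\<forall>x\<in>set \<rho>. x \<noteq> a" using nin ab by auto
    then have "takeWhile (\<lambda>x. x \<noteq> a) as = \<rho>" unfolding s(1) by (subst takeWhile_append2) auto
    then show ?thesis using s by simp
  qed
  have tw: "b \<notin> set (takeWhile (\<lambda>x. x \<noteq> a) (\<rho> @ ys))" if "a \<in> set \<rho>" "b \<notin> set \<rho>" for \<rho> ys
    using that by (auto simp: takeWhile_append1 dest: set_takeWhileD)
  have R2: "b \<notin> set (takeWhile (\<lambda>x. x \<noteq> a) as) \<and> last as \<noteq> b" if "as \<in> ?R2" for as
  proof -
    from that obtain X \<rho> where X: "X \<in> Pow A - {A}" "\<rho> \<in> perms_occ 0 ({a} \<union> X)"
      "as = glue_desc A b (X, \<rho>)" by blast
    then have s: "as = \<rho> @ b # desc_list (A - X)" "X \<subseteq> A" "X \<noteq> A" "set \<rho> = insert a X"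
      by (simp_all add: glue_desc_def perms_occ_iff)
    have setE: "set (desc_list (A - X)) = A - X" using A by simp
    have "desc_list (A - X) \<noteq> []" using s(2,3) setE by force
    then have "last as \<in> A" using s(1) setE last_in_set by fastforce
    moreover have "a \<in> set \<rho>" "b \<notin> set \<rho>" using s nin ab by auto
    ultimately show ?thesis using tw[of \<rho>] s(1) nin by auto
  qed
  have R3: "b \<notin> set (takeWhile (\<lambda>x. x \<noteq> a) as) \<and> last as = b" if "as \<in> ?R3" for as
  proof -
    from that obtain \<rho> where s: "as = \<rho> @ [b]" "set \<rho> = insert a A" by (auto simp: perms_occ_iff)
    then show ?thesis using tw[of \<rho> "[b]"] nin ab by auto
  qed
  have disj: "?R1 \<inter> ?R2 = {}" "(?R1 \<union> ?R2) \<inter> ?R3 = {}" using R1 R2 R3 by blast+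
  have fin: "finite ?R1" "finite ?R2" "finite ?R3" using A by auto
  have "card (perms_occ 1 (insert a (insert b A))) = card (?R1 \<union> ?R2 \<union> ?R3)"
    using perms_occ_1_insert_two_least[OF assms] by (rule arg_cong)
  also have "\<dots> = card ?R1 + card ?R2 + card ?R3"
    by (subst card_Un_disjoint[OF _ fin(3) disj(2)], rule finite_UnI[OF fin(1,2)],
        subst card_Un_disjoint[OF fin(1,2) disj(1)], rule refl)
  finally have "card (perms_occ 1 (insert a (insert b A))) = card ?R1 + card ?R2 + card ?R3" .
  moreover have "card ?R1 = (\<Sum>X\<in>Pow A. card (perms_occ 1 ({b} \<union> X)))"
    using A nin ab by (intro card_glue_desc) auto
  moreover have "card ?R2 = (\<Sum>X\<in>Pow A - {A}. card (perms_occ 0 ({a} \<union> X)))"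
    using A nin ab by (intro card_glue_desc) auto
  moreover have "card ?R3 = card (perms_occ 1 (insert a A))"
    by (intro card_image inj_onI) simp
  ultimately show ?thesis by simp
qed

section \<open>The recurrence for \<open>u1\<close>\<close>

lemma u1_eq_perms_occ: "finite S \<Longrightarrow> card (perms_occ 1 S) = u1 (card S)"
  using card_perms_occ_cong[of S "{1..card S}" 1] by (simp add: u1_def perms_occ_def)

lemma Bell_eq_perms_occ: "finite S \<Longrightarrow> card (perms_occ 0 S) = Bell (card S)"
  using card_perms_occ_cong[of S "{1..card S}" 0] card_perms_occ_0_eq_partitions[of "{1..card S}"]
  by (simp add: Bell_def)

text \<open>The index \<open>k\<close> is the size of \<open>X\<close>. One copy of
  \<open>u1 (n + 1)\<close> is the term \<open>X = A\<close> of the first sum, the other counts the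
  words ending in 2. The Bell sum stops before \<open>n\<close> because \<open>X = A\<close> is
  excluded there.\<close>

lemma u1_recurrence:
  "u1 (n + 2) = 2 * u1 (n + 1) + (\<Sum>k<n. (n choose k) * (u1 (k + 1) + Bell (k + 1)))"
proof -
  define A where "A = {3..n + 2}"
  have A: "finite A" "card A = n" "1 \<notin> A" "2 \<notin> A" by (auto simp: A_def)
  have "u1 (n + 2) = card (perms_occ 1 (insert 1 (insert 2 A)))"
    using A by (subst u1_eq_perms_occ) auto
  also have "\<dots> = (\<Sum>X\<in>Pow A. card (perms_occ 1 ({2} \<union> X))) +
      (\<Sum>X\<in>Pow A - {A}. card (perms_occ 0 ({1} \<union> X))) + card (perms_occ 1 (insert 1 A))"
    by (rule card_perms_occ_1_insert_two_least) (auto simp: A_def)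
  also have "card (perms_occ 1 (insert 1 A)) = u1 (n + 1)"
    using A by (subst u1_eq_perms_occ) auto
  also have "(\<Sum>X\<in>Pow A. card (perms_occ 1 ({2} \<union> X))) = (\<Sum>X\<in>Pow A. u1 (card X + 1))"
  proof (intro sum.cong refl)
    fix X assume "X \<in> Pow A"
    then have "finite X" "2 \<notin> X" using A finite_subset by auto
    then show "card (perms_occ 1 ({2} \<union> X)) = u1 (card X + 1)"
      by (subst u1_eq_perms_occ) auto
  qed
  also have "\<dots> = (\<Sum>k<n. (n choose k) * u1 (k + 1)) + u1 (n + 1)"
    using sum_Pow_card[OF A(1), of "\<lambda>k. u1 (k + 1)"] A
    by (simp add: lessThan_Suc_atMost[symmetric])
  also have "(\<Sum>X\<in>Pow A - {A}. card (perms_occ 0 ({1} \<union> X))) = (\<Sum>X\<in>Pow A - {A}. Bell (card X + 1))"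
  proof (intro sum.cong refl)
    fix X assume "X \<in> Pow A - {A}"
    then have "finite X" "1 \<notin> X" using A finite_subset by auto
    then show "card (perms_occ 0 ({1} \<union> X)) = Bell (card X + 1)" by (simp add: Bell_eq_perms_occ)
  qed
  also have "\<dots> = (\<Sum>k<n. (n choose k) * Bell (k + 1))"
    using sum_psubsets_card[OF A(1), of "\<lambda>k. Bell (k + 1)"] A by simp
  finally show ?thesis
    by (simp add: sum.distrib distrib_left)
qed

text \<open>An occurrence takes up three positions \<open>i < j < j + 1\<close>.\<close>

lemma u1_less_3:
  assumes "n < 3"
  shows "u1 n = 0"
proof -
  have "occ_1_23 as = {}" if "as \<in> permutations_of_set {1..n}" for as
  proof -
    have "length as = n" using that by (simp add: length_finite_permutations_of_set)
    then show ?thesis using assms by (auto simp: occ_1_23_def)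
  qed
  then show ?thesis by (auto simp: u1_def)
qed

theorem theorem2:
  shows "u1 0 = 0 \<and>
    (\<forall>n::int. n \<ge> -1 \<longrightarrow>
      u1 (nat (n + 2)) = 2 * u1 (nat (n + 1))
        + (\<Sum>k<nat n. (nat n choose k) * (u1 (k + 1) + Bell (k + 1))))"
proof (intro conjI allI impI)
  show "u1 0 = 0" by (simp add: u1_less_3)
next
  fix n :: int assume "n \<ge> -1"
  then consider "n = -1" | m where "n = int m" 
    by (cases n) fastforce+
  then show "u1 (nat (n + 2)) = 2 * u1 (nat (n + 1))
        + (\<Sum>k<nat n. (nat n choose k) * (u1 (k + 1) + Bell (k + 1)))"
  proof cases
    \<comment> \<open>For \<open>n = -1\<close> the claim is \<open>u1 1 = 2 * u1 0\<close>:
      \<open>nat n\<close> is 0, so the sum is empty, and both values of \<open>u1\<close>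
      vanish.\<close>
    case 1
    then show ?thesis by (simp add: u1_less_3)
  next
    case 2
    then have "nat (n + 2) = m + 2" "nat (n + 1) = m + 1" "nat n = m" by auto
    then show ?thesis by (simp only: u1_recurrence)
  qed
qed

end
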